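(* There is an online algorithm with advice for online unit clustering in $\mathbb{Z}$ which, on every request sequence consisting of $n$ points, reads at most $\lfloor n/2\rfloor$ bits of advice and clusters the sequence optimally (using the minimum possible number of clusters).
   Context: Online unit clustering in $\mathbb{Z}$: integer points arrive one by one; upon arrival each point must be irrevocably assigned to a cluster (an existing one or a newly opened one), and every cluster must have diameter at most $1$ (so a cluster contains at most two distinct consecutive integers). The cost is the number of clusters. Online algorithm with advice (tape model): an oracle knowing the whole input writes an infinite binary advice tape, which the algorithm may read sequentially; the number of advice bits used is the number of bits read. *)

theory Defs
  imports "HOL-Analysis.Analysis"
begin

text \<open>
  A solution for a request sequence is a list of cluster labels, the \<open>i\<close>-th label being the cluster
  of the \<open>i\<close>-th request.  Labels carry no meaning: using a label that did not occur before is opening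
  a new cluster.  Requests may repeat.
\<close>

definition cluster :: "int list \<Rightarrow> nat list \<Rightarrow> nat \<Rightarrow> int set" where
  "cluster \<sigma> cs c = {\<sigma> ! i |i. i < length \<sigma> \<and> cs ! i = c}"

definition unit_clustering :: "int list \<Rightarrow> nat list \<Rightarrow> bool" where
  "unit_clustering \<sigma> cs \<longleftrightarrow>
     length cs = length \<sigma> \<and> (\<forall>c \<in> set cs. diameter (real_of_int ` cluster \<sigma> cs c) \<le> 1)"

definition cost :: "nat list \<Rightarrow> nat" where
  "cost cs = card (set cs)"

definition optimal_clustering :: "int list \<Rightarrow> nat list \<Rightarrow> bool" where
  "optimal_clustering \<sigma> cs \<longleftrightarrow> is_arg_min cost (unit_clustering \<sigma>) cs"

text \<open>
  A deterministic online algorithm with advice sees the requests revealed so far (the last one being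
  the one to be served) and the advice bits read so far; it then either reads the next bit of the
  tape or irrevocably assigns the current request to a cluster.  Its earlier actions need not be
  passed as arguments, since the two lists determine them.
\<close>

datatype action = Read | Assign nat

type_synonym algorithm = "int list \<Rightarrow> bool list \<Rightarrow> action"

type_synonym tape = "nat \<Rightarrow> bool"

text \<open>
  \<open>serve A \<phi> \<sigma> b b' c\<close>: with \<open>b\<close> bits of \<open>\<phi>\<close> already read, \<open>A\<close> serves the last request of \<open>\<sigma>\<close> by
  reading \<open>b' - b\<close> further bits and then assigning that request to cluster \<open>c\<close>.
\<close>

definition serve :: "algorithm \<Rightarrow> tape \<Rightarrow> int list \<Rightarrow> nat \<Rightarrow> nat \<Rightarrow> nat \<Rightarrow> bool" where
  "serve A \<phi> \<sigma> b b' c \<longleftrightarrow>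
     b \<le> b' \<and>
     (\<forall>k. b \<le> k \<and> k < b' \<longrightarrow> A \<sigma> (map \<phi> [0..<k]) = Read) \<and>
     A \<sigma> (map \<phi> [0..<b']) = Assign c"

text \<open>
  \<open>run A \<phi> \<sigma> cs b\<close>: on tape \<open>\<phi>\<close>, \<open>A\<close> serves all of \<open>\<sigma>\<close>, outputs \<open>cs\<close> and reads exactly \<open>b\<close> bits.
\<close>

inductive run :: "algorithm \<Rightarrow> tape \<Rightarrow> int list \<Rightarrow> nat list \<Rightarrow> nat \<Rightarrow> bool"
  for A :: algorithm and \<phi> :: tape where
  run_Nil: "run A \<phi> [] [] 0"
| run_snoc: "run A \<phi> \<sigma> cs b \<Longrightarrow> serve A \<phi> (\<sigma> @ [x]) b b' c \<Longrightarrow> run A \<phi> (\<sigma> @ [x]) (cs @ [c]) b'"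

lemma serve_unique:
  assumes "serve A \<phi> \<sigma> b b1 c1" "serve A \<phi> \<sigma> b b2 c2"
  shows "b1 = b2 \<and> c1 = c2"
  using assms unfolding serve_def
  by (metis action.distinct(1) action.inject linorder_neqE_nat)

lemma run_unique:
  assumes "run A \<phi> \<sigma> cs1 b1" "run A \<phi> \<sigma> cs2 b2"
  shows "cs1 = cs2 \<and> b1 = b2"
  using assms
proof (induction arbitrary: cs2 b2 rule: run.induct)
  case run_Nil
  then show ?case by (cases rule: run.cases) auto
next
  case (run_snoc \<sigma> cs b x b' c)
  from run_snoc.prems obtain cs' b'' c' where
    "run A \<phi> \<sigma> cs' b''" "serve A \<phi> (\<sigma> @ [x]) b'' b2 c'" "cs2 = cs' @ [c']"
    by (cases rule: run.cases) auto
  with run_snoc show ?case using serve_unique by metis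
qed

end

theory Submission
  imports Defs
begin

text \<open>
  Pairing the points of every maximal block of consecutive requested integers greedily from its left
  end is optimal: the left points of the pairs have pairwise distance at least 2, so they lie in
  distinct clusters of any unit clustering.  The pairing of a block is determined by the parity of
  its left end, a single bit.  The algorithm asks for this bit as late as possible, namely when a new
  point arrives next to a point that was isolated so far.  Every question thus raises the number of
  distinct revealed points with a revealed neighbour by at least 2, so there are at most \<open>n / 2\<close> of them.
\<close>

section \<open>Blocks, questions and the algorithm\<close>

definition linked :: "int set \<Rightarrow> int \<Rightarrow> int \<Rightarrow> bool" where
  "linked S x y \<longleftrightarrow> {min x y..max x y} \<subseteq> S"

text \<open>The condition \<open>s - 1 \<notin> S\<close> makes \<open>s\<close> the left end of the
  block of \<open>x\<close>. For finite \<open>S\<close> and \<open>x \<in> S\<close>, a false value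
  thus means an odd left end.\<close>

definition even_start :: "int set \<Rightarrow> int \<Rightarrow> bool" where
  "even_start S x \<longleftrightarrow> (\<exists>s\<le>x. even s \<and> s - 1 \<notin> S \<and> {s..x} \<subseteq> S)"

text \<open>If \<open>b\<close> is the bit of the block of \<open>x\<close>, the left points of
  pairs are those at even distance from the left end, that is, with \<open>even x = b\<close>. The
  mate need not be requested.\<close>

definition mate :: "bool \<Rightarrow> int \<Rightarrow> int" where
  "mate b x = (if even x = b then x + 1 else x - 1)"

definition nonisolated :: "int set \<Rightarrow> int set" where
  "nonisolated S = {x \<in> S. x - 1 \<in> S \<or> x + 1 \<in> S}"

text \<open>A point that also touches a nonisolated point asks all the same; hence an isolated point
  always gains its first neighbour through a question.\<close>

definition triggers :: "int set \<Rightarrow> int \<Rightarrow> bool" where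
  "triggers S x \<longleftrightarrow> x \<notin> S \<and> (\<exists>z \<in> S - nonisolated S. \<bar>z - x\<bar> = 1)"

text \<open>On the reversed list, \<open>set xs\<close> holds the points revealed before
  \<open>x\<close>; the questions still come out in order of arrival.\<close>

primrec questions_rev :: "int list \<Rightarrow> int list" where
  "questions_rev [] = []"
| "questions_rev (x # xs) = questions_rev xs @ (if triggers (set xs) x then [x] else [])"

definition questions :: "int list \<Rightarrow> int list" where
  "questions \<sigma> = questions_rev (rev \<sigma>)"

text \<open>
  A cluster is labelled by its first revealed point, so the label does not change as further points
  are revealed.
\<close>

definition label :: "int list \<Rightarrow> bool \<Rightarrow> int \<Rightarrow> nat" where
  "label \<sigma> b x = to_nat (hd (filter (\<lambda>z. z = x \<or> z = mate b x) \<sigma>))"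

text \<open>Merging can bring several questions into one block; correct answers agree there, so one
  true bit decides. An isolated point is linked to no question and gets
  \<open>False\<close>.\<close>

definition known_parity :: "int list \<Rightarrow> bool list \<Rightarrow> int \<Rightarrow> bool" where
  "known_parity \<sigma> bs x \<longleftrightarrow>
     (\<exists>i < length (questions \<sigma>). bs ! i \<and> linked (set \<sigma>) (questions \<sigma> ! i) x)"

definition pairing_algorithm :: algorithm where
  "pairing_algorithm \<sigma> bs =
     (if length bs < length (questions \<sigma>) then Read
      else Assign (label \<sigma> (known_parity \<sigma> bs (last \<sigma>)) (last \<sigma>)))"

text \<open>The bits describe the blocks of the whole sequence. Those past the last question are
  unspecified and never read.\<close>

definition parity_advice :: "int list \<Rightarrow> tape" where
  "parity_advice \<sigma> i = even_start (set \<sigma>) (questions \<sigma> ! i)"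

section \<open>The parity of the left end of a block\<close>

lemma linked_mono: "linked S x y \<Longrightarrow> S \<subseteq> T \<Longrightarrow> linked T x y"
  unfolding linked_def by blast

lemma linked_adjacent:
  assumes "x \<in> S" "y \<in> S" "\<bar>x - y\<bar> = 1"
  shows "linked S x y"
proof -
  have "{min x y..max x y} \<subseteq> {x, y}" using assms(3) by auto
  then show ?thesis using assms unfolding linked_def by blast
qed

lemma linked_step:
  assumes "linked S x y" "z \<in> S" "\<bar>z - y\<bar> = 1"
  shows "linked S x z"
proof -
  have "{min x z..max x z} \<subseteq> insert z {min x y..max x y}" using assms(3) by auto
  then show ?thesis using assms unfolding linked_def by blast
qed

lemma even_start_eq_interval:
  assumes "x \<le> y" "{x..y} \<subseteq> S"
  shows "even_start S x = even_start S y"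
proof
  assume "even_start S x"
  then obtain s where s: "s \<le> x" "even s" "s - 1 \<notin> S" "{s..x} \<subseteq> S"
    unfolding even_start_def by blast
  have "{s..y} \<subseteq> {s..x} \<union> {x..y}" by auto
  then have "{s..y} \<subseteq> S" using s assms by blast
  then show "even_start S y" unfolding even_start_def using s assms by (intro exI[of _ s]) auto
next
  assume "even_start S y"
  then obtain s where s: "s \<le> y" "even s" "s - 1 \<notin> S" "{s..y} \<subseteq> S"
    unfolding even_start_def by blast
  \<comment> \<open>A left end strictly right of \<open>x\<close> would have its predecessor in
    \<open>{x..y}\<close>, hence in \<open>S\<close>.\<close>
  have "s \<le> x"
  proof (rule ccontr)
    assume "\<not> s \<le> x"
    then have "s - 1 \<in> {x..y}" using s by auto
    then show False using s assms by blast
  qed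
  moreover have "{s..x} \<subseteq> {s..y}" using assms by auto
  ultimately show "even_start S x" unfolding even_start_def using s by (intro exI[of _ s]) auto
qed

lemma even_start_eq_linked:
  assumes "linked S x y"
  shows "even_start S x = even_start S y"
proof (cases "x \<le> y")
  case True
  then show ?thesis using assms even_start_eq_interval[of x y S] by (simp add: linked_def)
next
  case False
  then show ?thesis using assms even_start_eq_interval[of y x S] by (simp add: linked_def)
qed

lemma even_start_eq_adjacent:
  assumes "x \<in> S" "y \<in> S" "\<bar>x - y\<bar> = 1"
  shows "even_start S x = even_start S y"
  using linked_adjacent[OF assms] by (rule even_start_eq_linked)

text \<open>Such a point is not the left end of its block: an even left end differs from an odd
  \<open>x\<close>, and an even \<open>x\<close> without \<open>x - 1\<close> would itself be an
  even left end.\<close>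

lemma left_neighbour_of_right_point:
  assumes "x \<in> S" "even x \<noteq> even_start S x"
  shows "x - 1 \<in> S"
proof (cases "even_start S x")
  case True
  then obtain s where s: "s \<le> x" "even s" "{s..x} \<subseteq> S" unfolding even_start_def by blast
  have "s \<noteq> x" using s(2) True assms(2) by blast
  then have "x - 1 \<in> {s..x}" using s(1) by simp
  then show ?thesis using s(3) by blast
next
  case False
  then have "even x" using assms(2) by blast
  moreover have "{x..x} \<subseteq> S" using assms(1) by simp
  ultimately show ?thesis using False unfolding even_start_def by (meson order_refl)
qed

section \<open>Counting the questions\<close>

lemma questions_Nil [simp]: "questions [] = []"
  by (simp add: questions_def)

lemma questions_snoc [simp]:
  "questions (\<sigma> @ [x]) = questions \<sigma> @ (if triggers (set \<sigma>) x then [x] else [])"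
  by (simp add: questions_def)

text \<open>Later requests only append questions, so each question keeps its index on the
  tape.\<close>

lemma questions_append: "\<exists>qs. questions (\<sigma> @ \<tau>) = questions \<sigma> @ qs"
proof (induction \<tau> rule: rev_induct)
  case (snoc x \<tau>)
  then show ?case using questions_snoc[of "\<sigma> @ \<tau>" x] by auto
qed simp

lemma nonisolated_mono: "S \<subseteq> T \<Longrightarrow> nonisolated S \<subseteq> nonisolated T"
  unfolding nonisolated_def by auto

lemma finite_nonisolated: "finite S \<Longrightarrow> finite (nonisolated S)"
  unfolding nonisolated_def by simp

text \<open>Each question is charged to two fresh points: the arriving \<open>x\<close> and the
  hitherto isolated \<open>z\<close> both become nonisolated, and nonisolated points stay
  so.\<close>

lemma questions_le_nonisolated: "2 * length (questions \<sigma>) \<le> card (nonisolated (set \<sigma>))"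
proof (induction \<sigma> rule: rev_induct)
  case (snoc x \<sigma>)
  let ?S = "set \<sigma>" and ?T = "set (\<sigma> @ [x])"
  have fin: "finite (nonisolated ?T)" "finite (nonisolated ?S)" by (simp_all add: finite_nonisolated)
  have mono: "nonisolated ?S \<subseteq> nonisolated ?T" by (rule nonisolated_mono) auto
  show ?case
  proof (cases "triggers ?S x")
    case True
    then obtain z where z: "x \<notin> ?S" "z \<in> ?S" "z \<notin> nonisolated ?S" "\<bar>z - x\<bar> = 1"
      unfolding triggers_def by blast
    have x: "x \<notin> nonisolated ?S" "x \<noteq> z" using z unfolding nonisolated_def by auto
    have "z = x - 1 \<or> z = x + 1" using z by linarith
    then have "{x, z} \<subseteq> nonisolated ?T" using z unfolding nonisolated_def by auto
    then have "insert x (insert z (nonisolated ?S)) \<subseteq> nonisolated ?T" using mono by blast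
    then have "card (insert x (insert z (nonisolated ?S))) \<le> card (nonisolated ?T)"
      using fin by (intro card_mono)
    then show ?thesis using snoc True x z fin by simp
  next
    case False
    then show ?thesis using snoc card_mono[OF fin(1) mono] by simp
  qed
qed simp

lemma length_questions_le: "length (questions \<sigma>) \<le> length \<sigma> div 2"
proof -
  have "card (nonisolated (set \<sigma>)) \<le> card (set \<sigma>)"
    by (intro card_mono) (auto simp: nonisolated_def)
  also have "\<dots> \<le> length \<sigma>" by (rule card_length)
  finally show ?thesis using questions_le_nonisolated[of \<sigma>] by linarith
qed

section \<open>Correctness of the known bits and of the run\<close>

text \<open>A formerly isolated point gains its neighbour through a question. An arriving point
  either is a question or touches a nonisolated point, whose link to a question extends by one
  step.\<close>

lemma nonisolated_linked_to_question:
  assumes "x \<in> nonisolated (set \<sigma>)"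
  shows "\<exists>q \<in> set (questions \<sigma>). linked (set \<sigma>) q x"
  using assms
proof (induction \<sigma> arbitrary: x rule: rev_induct)
  case Nil
  then show ?case by (simp add: nonisolated_def)
next
  case (snoc y \<sigma>)
  let ?S = "set \<sigma>" and ?T = "set (\<sigma> @ [y])"
  have old: "\<exists>q \<in> set (questions (\<sigma> @ [y])). linked ?T q z" if "z \<in> nonisolated ?S" for z
    using snoc.IH[OF that] linked_mono[of ?S _ z ?T] by auto
  have new: "y \<in> set (questions (\<sigma> @ [y]))"
    if "z \<in> ?S" "z \<notin> nonisolated ?S" "\<bar>z - y\<bar> = 1" "y \<notin> ?S" for z
    using that by (auto simp: triggers_def)
  \<comment> \<open>A repeated request \<open>y\<close> leaves the set of points unchanged and falls
    under the first case.\<close>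
  consider "x \<in> nonisolated ?S" | "x \<notin> nonisolated ?S" "y \<notin> ?S" "x = y"
    | "x \<notin> nonisolated ?S" "y \<notin> ?S" "x \<noteq> y"
    using snoc.prems by (cases "y \<in> ?S") (auto simp: insert_absorb)
  then show ?case
  proof cases
    case 1
    then show ?thesis by (rule old)
  next
    case 2
    have "y - 1 \<in> ?S \<or> y + 1 \<in> ?S" using snoc.prems 2 by (simp add: nonisolated_def)
    then obtain z where z: "z \<in> ?S" "\<bar>z - y\<bar> = 1"
    proof
      assume "y - 1 \<in> ?S"
      then show thesis using that[of "y - 1"] by simp
    next
      assume "y + 1 \<in> ?S"
      then show thesis using that[of "y + 1"] by simp
    qed
    show ?thesis
    proof (cases "z \<in> nonisolated ?S")
      case True
      then obtain q where q: "q \<in> set (questions (\<sigma> @ [y]))" "linked ?T q z" using old by blast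
      have "linked ?T q y" using linked_step[OF q(2), of y] z(2) by simp
      then show ?thesis using q 2 by blast
    next
      case False
      have "linked ?T y y" by (simp add: linked_def)
      then show ?thesis using new[OF z(1) False z(2)] 2 by blast
    qed
  next
    case 3
    then have x: "x \<in> ?S" "\<bar>x - y\<bar> = 1"
      using snoc.prems unfolding nonisolated_def by auto
    have "linked ?T y x" using x by (intro linked_adjacent) auto
    then show ?thesis using new[OF x(1) _ x(2)] 3 by blast
  qed
qed

text \<open>Links in the prefix persist in \<open>\<sigma>\<close>, so every question linked to
  \<open>x\<close> carries the bit of the final block of \<open>x\<close>; at least one exists
  because \<open>x\<close> is nonisolated.\<close>

lemma known_parity_eq:
  assumes \<sigma>: "\<sigma> = \<sigma>' @ \<tau>" and x: "x \<in> nonisolated (set \<sigma>')"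
  shows "known_parity \<sigma>' (map (parity_advice \<sigma>) [0..<length (questions \<sigma>')]) x
         = even_start (set \<sigma>) x"
proof -
  obtain qs where qs: "questions \<sigma> = questions \<sigma>' @ qs" using questions_append \<sigma> by blast
  have bit: "map (parity_advice \<sigma>) [0..<length (questions \<sigma>')] ! i = even_start (set \<sigma>) x"
    if "i < length (questions \<sigma>')" "linked (set \<sigma>') (questions \<sigma>' ! i) x" for i
  proof -
    have l: "linked (set \<sigma>) (questions \<sigma>' ! i) x" using that \<sigma> by (intro linked_mono[OF that(2)]) auto
    then show ?thesis using that qs even_start_eq_linked[OF l] by (simp add: parity_advice_def nth_append)
  qed
  obtain i where "i < length (questions \<sigma>')" "linked (set \<sigma>') (questions \<sigma>' ! i) x"
    using nonisolated_linked_to_question[OF x] by (metis in_set_conv_nth)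
  then show ?thesis unfolding known_parity_def using bit by blast
qed

text \<open>The label assigned on arrival is the final one. The bit matters only once a possible
  mate is revealed, that is, once \<open>x\<close> is nonisolated.\<close>

lemma label_prefix:
  assumes \<sigma>: "\<sigma> = \<sigma>' @ \<tau>" and x: "x \<in> set \<sigma>'"
    and b: "x \<in> nonisolated (set \<sigma>') \<Longrightarrow> b = b'"
  shows "label \<sigma>' b x = label \<sigma> b' x"
proof -
  \<comment> \<open>If \<open>b \<noteq> b'\<close>, the two mates are \<open>x - 1\<close> and
    \<open>x + 1\<close>, and neither occurs in \<open>\<sigma>'\<close>.\<close>
  have "z = x \<or> z = mate b x \<longleftrightarrow> z = x \<or> z = mate b' x" if "z \<in> set \<sigma>'" for z
    using that b x by (cases "b = b'") (auto simp: mate_def nonisolated_def split: if_splits)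
  then have eq: "filter (\<lambda>z. z = x \<or> z = mate b x) \<sigma>' = filter (\<lambda>z. z = x \<or> z = mate b' x) \<sigma>'"
    by (intro filter_cong) auto
  have "filter (\<lambda>z. z = x \<or> z = mate b' x) \<sigma>' \<noteq> []" using x by (auto simp: filter_empty_conv)
  then show ?thesis unfolding label_def eq \<sigma> by simp
qed

definition pairing :: "int list \<Rightarrow> nat list" where
  "pairing \<sigma> = map (\<lambda>x. label \<sigma> (even_start (set \<sigma>) x) x) \<sigma>"

text \<open>Tape and labels stay those of the whole \<open>\<sigma>\<close> while the induction runs
  over its prefixes.\<close>

lemma run_prefix:
  assumes "\<sigma> = \<sigma>' @ \<tau>"
  shows "run pairing_algorithm (parity_advice \<sigma>) \<sigma>'
           (map (\<lambda>x. label \<sigma> (even_start (set \<sigma>) x) x) \<sigma>') (length (questions \<sigma>'))"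
  using assms
proof (induction \<sigma>' arbitrary: \<tau> rule: rev_induct)
  case Nil
  then show ?case by (simp add: run_Nil)
next
  case (snoc x \<sigma>')
  let ?p = "\<sigma>' @ [x]"
  let ?bs = "map (parity_advice \<sigma>) [0..<length (questions ?p)]"
  have "label ?p (known_parity ?p ?bs x) x = label \<sigma> (even_start (set \<sigma>) x) x"
    using known_parity_eq[OF snoc.prems] by (intro label_prefix[OF snoc.prems]) auto
  \<comment> \<open>The request adds at most one question, so at most one bit is read here.\<close>
  then have "serve pairing_algorithm (parity_advice \<sigma>) ?p (length (questions \<sigma>'))
      (length (questions ?p)) (label \<sigma> (even_start (set \<sigma>) x) x)"
    unfolding serve_def pairing_algorithm_def by auto
  from run_snoc[OF snoc.IH[of "x # \<tau>"] this] snoc.prems show ?case by simp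
qed

lemma run_pairing_algorithm:
  "run pairing_algorithm (parity_advice \<sigma>) \<sigma> (pairing \<sigma>) (length (questions \<sigma>))"
  unfolding pairing_def using run_prefix[of \<sigma> \<sigma> "[]"] by simp

section \<open>Feasibility of the pairing\<close>

lemma diameter_int_le_1_iff:
  fixes S :: "int set"
  assumes "finite S"
  shows "diameter (real_of_int ` S) \<le> 1 \<longleftrightarrow> (\<forall>x\<in>S. \<forall>y\<in>S. \<bar>x - y\<bar> \<le> 1)"
proof
  assume d: "diameter (real_of_int ` S) \<le> 1"
  show "\<forall>x\<in>S. \<forall>y\<in>S. \<bar>x - y\<bar> \<le> 1"
  proof (intro ballI)
    fix x y assume "x \<in> S" "y \<in> S"
    then have "dist (real_of_int x) (real_of_int y) \<le> diameter (real_of_int ` S)"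
      using assms by (intro diameter_bounded_bound finite_imp_bounded) auto
    then have "\<bar>real_of_int x - real_of_int y\<bar> \<le> 1" using d by (simp add: dist_real_def)
    then show "\<bar>x - y\<bar> \<le> 1" by linarith
  qed
next
  assume "\<forall>x\<in>S. \<forall>y\<in>S. \<bar>x - y\<bar> \<le> 1"
  then have "norm (real_of_int x - real_of_int y) \<le> 1" if "x \<in> S" "y \<in> S" for x y
    using that by (metis of_int_abs of_int_diff of_int_le_1_iff real_norm_def)
  then show "diameter (real_of_int ` S) \<le> 1" by (intro diameter_le) auto
qed

lemma finite_cluster: "finite (cluster \<sigma> cs c)"
  unfolding cluster_def by auto

lemma unit_clustering_iff:
  "unit_clustering \<sigma> cs \<longleftrightarrow> length cs = length \<sigma> \<and>
     (\<forall>i<length \<sigma>. \<forall>j<length \<sigma>. cs ! i = cs ! j \<longrightarrow> \<bar>\<sigma> ! i - \<sigma> ! j\<bar> \<le> 1)"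
proof -
  have "(\<forall>c \<in> set cs. \<forall>x \<in> cluster \<sigma> cs c. \<forall>y \<in> cluster \<sigma> cs c. \<bar>x - y\<bar> \<le> 1) \<longleftrightarrow>
      (\<forall>i<length \<sigma>. \<forall>j<length \<sigma>. cs ! i = cs ! j \<longrightarrow> \<bar>\<sigma> ! i - \<sigma> ! j\<bar> \<le> 1)" (is "?L \<longleftrightarrow> ?R")
    if len: "length cs = length \<sigma>"
  proof
    assume L: ?L
    show ?R
    proof (intro allI impI)
      fix i j assume ij: "i < length \<sigma>" "j < length \<sigma>" "cs ! i = cs ! j"
      then have "\<sigma> ! i \<in> cluster \<sigma> cs (cs ! i)" "\<sigma> ! j \<in> cluster \<sigma> cs (cs ! i)"
        unfolding cluster_def by auto
      moreover have "cs ! i \<in> set cs" using ij len by simp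
      ultimately show "\<bar>\<sigma> ! i - \<sigma> ! j\<bar> \<le> 1" using L by blast
    qed
  qed (auto simp: cluster_def)
  then show ?thesis
    unfolding unit_clustering_def diameter_int_le_1_iff[OF finite_cluster] by blast
qed

text \<open>Equal labels mean a common first revealed point \<open>r\<close>. As \<open>mate\<close>
  is an involution for a fixed bit and the bit is constant on a block, both points lie in the pair
  of \<open>r\<close>.\<close>

lemma label_eq_imp_near:
  assumes x: "x \<in> set \<sigma>" and y: "y \<in> set \<sigma>"
    and eq: "label \<sigma> (even_start (set \<sigma>) x) x = label \<sigma> (even_start (set \<sigma>) y) y"
  shows "\<bar>x - y\<bar> \<le> 1"
proof -
  let ?F = "\<lambda>z. filter (\<lambda>w. w = z \<or> w = mate (even_start (set \<sigma>) z) z) \<sigma>"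
  define r where "r = hd (?F x)"
  have r_y: "r = hd (?F y)" using eq unfolding label_def r_def by simp
  have hd_F: "hd (?F z) \<in> set (?F z)" if "z \<in> set \<sigma>" for z
    using that by (intro hd_in_set) (auto simp: filter_empty_conv)
  have r_in: "r \<in> set (?F x)" "r \<in> set (?F y)"
    using hd_F[OF x] hd_F[OF y] r_y unfolding r_def by simp_all
  have "z = r \<or> z = mate (even_start (set \<sigma>) r) r" if z: "z \<in> set \<sigma>" "r \<in> set (?F z)" for z
  proof (cases "z = r")
    case False
    then have r: "r \<in> set \<sigma>" "r = mate (even_start (set \<sigma>) z) z" using z(2) by auto
    then have "\<bar>z - r\<bar> = 1" by (simp add: mate_def)
    then have par: "even_start (set \<sigma>) r = even_start (set \<sigma>) z"
      using even_start_eq_adjacent[OF z(1) r(1)] by simp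
    have "mate b (mate b z) = z" for b by (simp add: mate_def)
    then show ?thesis unfolding par using r(2) by simp
  qed simp
  from this[OF x r_in(1)] this[OF y r_in(2)] show ?thesis by (auto simp: mate_def)
qed

lemma unit_clustering_pairing: "unit_clustering \<sigma> (pairing \<sigma>)"
  unfolding unit_clustering_iff pairing_def by (auto intro!: label_eq_imp_near)

section \<open>Left points and optimality\<close>

definition left_points :: "int set \<Rightarrow> int set" where
  "left_points S = {x \<in> S. even x = even_start S x}"

text \<open>Every right point shares the label of its left neighbour, which is a left point, so left
  points already produce all labels.\<close>

lemma cost_pairing_le: "cost (pairing \<sigma>) \<le> card (left_points (set \<sigma>))"
proof -
  let ?S = "set \<sigma>"
  let ?l = "\<lambda>x. label \<sigma> (even_start ?S x) x"
  have "?l x \<in> ?l ` left_points ?S" if x: "x \<in> ?S" for x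
  proof (cases "x \<in> left_points ?S")
    case False
    then have odd: "even x \<noteq> even_start ?S x" using x by (simp add: left_points_def)
    then have l: "x - 1 \<in> ?S" using left_neighbour_of_right_point[of x ?S] x by simp
    then have eq: "even_start ?S (x - 1) = even_start ?S x"
      using x by (intro even_start_eq_adjacent) auto
    have "x - 1 \<in> left_points ?S" using odd l eq by (auto simp: left_points_def)
    moreover have "?l (x - 1) = ?l x"
    \<comment> \<open>Each of the two points is the mate of the other, so both labels are heads of
      the same filtered list.\<close>
    proof -
      have "mate (even_start ?S x) x = x - 1" "mate (even_start ?S x) (x - 1) = x"
        using odd by (auto simp: mate_def)
      then show ?thesis unfolding eq label_def by (simp add: disj_commute)
    qed
    ultimately show ?thesis by (intro image_eqI[of _ _ "x - 1"]) simp_all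
  qed blast
  then have "set (pairing \<sigma>) \<subseteq> ?l ` left_points ?S" unfolding pairing_def by auto
  moreover have fin: "finite (left_points ?S)" by (simp add: left_points_def)
  ultimately have "card (set (pairing \<sigma>)) \<le> card (?l ` left_points ?S)" by (intro card_mono) auto
  also have "\<dots> \<le> card (left_points ?S)" using fin by (rule card_image_le)
  finally show ?thesis unfolding cost_def .
qed

text \<open>Adjacent points of \<open>S\<close> share the bit of their block but have opposite
  parity.\<close>

lemma left_points_eq_if_near:
  assumes "x \<in> left_points S" "y \<in> left_points S" "\<bar>x - y\<bar> \<le> 1"
  shows "x = y"
proof (rule ccontr)
  assume "x \<noteq> y"
  then have d: "\<bar>x - y\<bar> = 1" using assms by linarith
  then have "even x = even y"
    using assms even_start_eq_adjacent[of x S y] by (simp add: left_points_def)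
  moreover have "x = y + 1 \<or> y = x + 1" using d by linarith
  ultimately show False by auto
qed

lemma card_left_points_le_cost:
  assumes "unit_clustering \<sigma> cs"
  shows "card (left_points (set \<sigma>)) \<le> cost cs"
proof -
  \<comment> \<open>Labels belong to positions, so \<open>f\<close> picks one position for each left
    point.\<close>
  have "\<forall>x \<in> left_points (set \<sigma>). \<exists>i<length \<sigma>. \<sigma> ! i = x"
    by (auto simp: left_points_def in_set_conv_nth)
  then obtain f where f: "\<And>x. x \<in> left_points (set \<sigma>) \<Longrightarrow> f x < length \<sigma> \<and> \<sigma> ! f x = x"
    by metis
  have "inj_on (\<lambda>x. cs ! f x) (left_points (set \<sigma>))"
  proof (rule inj_onI)
    fix x y assume *: "x \<in> left_points (set \<sigma>)" "y \<in> left_points (set \<sigma>)" "cs ! f x = cs ! f y"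
    then have "\<bar>x - y\<bar> \<le> 1" using assms f unfolding unit_clustering_iff by metis
    then show "x = y" using * left_points_eq_if_near by blast
  qed
  moreover have "(\<lambda>x. cs ! f x) ` left_points (set \<sigma>) \<subseteq> set cs"
    using assms f unfolding unit_clustering_iff by auto
  ultimately show ?thesis unfolding cost_def by (intro card_inj_on_le) auto
qed

text \<open>The number of left points bounds the cost of \<open>pairing\<close> from above and that
  of every unit clustering from below.\<close>

lemma optimal_clustering_pairing: "optimal_clustering \<sigma> (pairing \<sigma>)"
  unfolding optimal_clustering_def is_arg_min_def
  using unit_clustering_pairing cost_pairing_le card_left_points_le_cost
  by (meson linorder_not_less order_trans)

theorem theorem4:
  shows "\<exists>(A :: algorithm) (advice :: int list \<Rightarrow> tape). \<forall>\<sigma> :: int list. \<exists>cs b.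
           run A (advice \<sigma>) \<sigma> cs b \<and> b \<le> length \<sigma> div 2 \<and> optimal_clustering \<sigma> cs"
  using run_pairing_algorithm length_questions_le optimal_clustering_pairing by blast

end
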